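(* For $(a,b,c)\in\Theta_v$, the Fisher information matrix of the family of Poincaré distributions in the coordinates $(a,b,c)$ is the symmetric matrix $I(a,b,c)=(I_{ij})_{1\le i,j\le3}$ with entries $$I_{11}=\frac{c^2\sqrt{ac-b^2}+ac^3-b^2c^2}{\sqrt{ac-b^2}\,(2a^2c^2-4ab^2c+2b^4)},\qquad I_{12}=-\frac{bc\sqrt{ac-b^2}+abc^2-b^3c}{\sqrt{ac-b^2}\,(a^2c^2-2ab^2c+b^4)},$$ $$I_{13}=-\frac{(ac-2b^2)\sqrt{ac-b^2}-b^2}{2a^2c^2-4ab^2c+2b^4},\qquad I_{22}=\frac{2ac\sqrt{ac-b^2}+ac+b^2}{a^2c^2-2ab^2c+b^4},$$ $$I_{23}=-\frac{ab\sqrt{ac-b^2}+a^2bc-ab^3}{\sqrt{ac-b^2}\,(a^2c^2-2ab^2c+b^4)},\qquad I_{33}=\frac{a^2\sqrt{ac-b^2}+a^3c-a^2b^2}{\sqrt{ac-b^2}\,(2a^2c^2-4ab^2c+2b^4)}.$$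
   Context: $\Theta_v=\{(a,b,c)\in\mathbb{R}^3:a>0,\ c>0,\ ac-b^2>0\}$. For $\theta_v=(a,b,c)\in\Theta_v$, the Poincaré distribution is the probability distribution on $\mathbb{H}=\{(x,y)\in\mathbb{R}^2:y>0\}$ with density (with respect to $dx\,dy$) $$p_{\theta_v}(x,y)=\frac{\sqrt{ac-b^2}\,e^{2\sqrt{ac-b^2}}}{\pi}\exp\left(-\frac{a(x^2+y^2)+2bx+c}{y}\right)\frac1{y^2}.$$ The Fisher information matrix is $I(\theta_v)=-E_{p_{\theta_v}}\left[\nabla^2_{\theta_v}\log p_{\theta_v}\right]$, with indices $1,2,3$ corresponding to $a,b,c$. *)

theory Defs
  imports "HOL-Analysis.Analysis"
begin

definition partial_deriv :: "'n \<Rightarrow> (real ^ 'n \<Rightarrow> real) \<Rightarrow> real ^ 'n \<Rightarrow> real" where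
  "partial_deriv i f \<theta> = deriv (\<lambda>t. f (\<theta> + t *\<^sub>R axis i 1)) 0"

definition hessian :: "(real ^ 'n \<Rightarrow> real) \<Rightarrow> real ^ 'n \<Rightarrow> real ^ 'n ^ 'n" where
  "hessian f \<theta> = (\<chi> i j. partial_deriv i (partial_deriv j f) \<theta>)"

text \<open>The expectation of the matrix-valued Hessian is a Bochner integral in \<open>real ^ 'n ^ 'n\<close>,
  taken with respect to the distribution whose density relative to \<open>\<mu>\<close> is \<open>p \<theta>\<close>.\<close>

definition fisher_information ::
    "'a measure \<Rightarrow> (real ^ 'n \<Rightarrow> 'a \<Rightarrow> real) \<Rightarrow> real ^ 'n \<Rightarrow> real ^ 'n ^ 'n" where
  "fisher_information \<mu> p \<theta> =
     - (\<integral>\<omega>. hessian (\<lambda>\<eta>. ln (p \<eta> \<omega>)) \<theta> \<partial>density \<mu> (\<lambda>\<omega>. ennreal (p \<theta> \<omega>)))"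

definition upper_half_plane :: "(real \<times> real) set" where
  "upper_half_plane = {(x, y). y > 0}"

definition Theta_v :: "(real ^ 3) set" where
  "Theta_v = {\<theta>. \<theta> $ 1 > 0 \<and> \<theta> $ 3 > 0 \<and> \<theta> $ 1 * \<theta> $ 3 - (\<theta> $ 2)\<^sup>2 > 0}"

text \<open>Only the values on \<^const>\<open>upper_half_plane\<close> and for parameters in \<^const>\<open>Theta_v\<close>
  are meaningful.\<close>

definition poincare_density :: "real ^ 3 \<Rightarrow> real \<times> real \<Rightarrow> real" where
  "poincare_density \<theta> = (\<lambda>(x, y).
     let a = \<theta> $ 1; b = \<theta> $ 2; c = \<theta> $ 3 in
       sqrt (a * c - b\<^sup>2) * exp (2 * sqrt (a * c - b\<^sup>2)) / pi
       * exp (- ((a * (x\<^sup>2 + y\<^sup>2) + 2 * b * x + c) / y)) * (1 / y\<^sup>2))"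

definition poincare_fisher_information :: "real ^ 3 \<Rightarrow> real ^ 3 ^ 3" where
  "poincare_fisher_information =
     fisher_information (restrict_space lborel upper_half_plane) poincare_density"

end

theory Submission
  imports Defs "HOL-Probability.Probability" "HOL-Real_Asymp.Real_Asymp"
begin

text \<open>The log-density is \<open>ln D / 2 + 2 sqrt D\<close>, with \<open>D = a c - b\<^sup>2\<close>, plus a function affine in
  \<open>(a, b, c)\<close>.  Hence its Hessian does not depend on the point of the half-plane, and its
  expectation is the Hessian itself as soon as the density has total mass 1.  For the latter,
  integrating over \<open>x\<close> is a Gaussian integral, which leaves an inverse Gaussian integral
  over \<open>y\<close>.\<close>

section \<open>The normal distribution function and the inverse Gaussian integral\<close>

text \<open>Near \<open>x\<close> the distribution function is a constant plus the integral of
  \<open>f\<close> from \<open>x - 1\<close>, so the fundamental theorem of calculus applies.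
  Starting one unit to the left makes \<open>x\<close> an interior point, which gives a two-sided
  derivative. The lemma serves to differentiate the normal distribution function.\<close>

lemma has_real_derivative_cdf_density:
  fixes f :: "real \<Rightarrow> real"
  assumes "real_distribution (density lborel f)"
    and cont: "continuous_on UNIV f" and nonneg: "\<And>x. 0 \<le> f x"
  shows "(cdf (density lborel f) has_real_derivative f x) (at x)"
proof -
  let ?M = "density lborel f"
  interpret real_distribution ?M by fact
  have [measurable]: "f \<in> borel_measurable borel"
    using cont by (rule borel_measurable_continuous_onI)
  have cdf_eq: "cdf ?M t = cdf ?M (x - 1) + integral {x - 1..t} f" if "x - 1 < t" for t
  proof -
    have int: "f integrable_on {x - 1..t}"
      by (intro integrable_continuous_interval continuous_on_subset[OF cont]) auto
    \<comment> \<open>A difference of cdf values measures the half-open interval, the integral the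
      closed one; the two agree because Lebesgue measure has no atoms.\<close>
    have "emeasure ?M {x - 1<..t} = emeasure ?M {x - 1..t}"
    proof (rule emeasure_eq_AE)
      have "AE z in lborel. z \<noteq> x - 1"
        by (rule AE_lborel_singleton)
      then show "AE z in ?M. (z \<in> {x - 1<..t}) = (z \<in> {x - 1..t})"
        by (subst AE_density) auto
    qed auto
    also have "\<dots> = (\<integral>\<^sup>+z. ennreal (f z) * indicator {x - 1..t} z \<partial>lborel)"
      by (rule emeasure_density) auto
    also have "\<dots> = ennreal (integral {x - 1..t} f)"
      using int nonneg by (intro nn_integral_has_integral_lebesgue') (auto simp: has_integral_integral)
    finally have "measure ?M {x - 1<..t} = integral {x - 1..t} f"
      using nonneg by (simp add: measure_def integral_nonneg int)
    then show ?thesis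
      using cdf_diff_eq[OF that] by simp
  qed
  have "((\<lambda>t. integral {x - 1..t} f) has_real_derivative f x) (at x within {x - 1..x + 1})"
    by (rule integral_has_real_derivative) (auto intro: continuous_on_subset[OF cont])
  then have "((\<lambda>t. integral {x - 1..t} f) has_real_derivative f x) (at x)"
    by (simp add: at_within_Icc_at)
  then have "((\<lambda>t. cdf ?M (x - 1) + integral {x - 1..t} f) has_real_derivative f x) (at x)"
    by (auto intro!: derivative_eq_intros)
  then show ?thesis
  proof (rule has_field_derivative_transform_within_open)
    show "open {x - 1<..}" by simp
  qed (auto simp: cdf_eq)
qed

text \<open>With \<open>\<Phi>\<close> the standard normal
  distribution function, an antiderivative of the integrand is, up to the factor
  \<open>sqrt pi / q\<close>,
  \<open>exp (- 2 p q) \<Phi> (sqrt 2 (p sqrt y - q / sqrt y)) - exp (2 p q) \<Phi> (sqrt 2 (p sqrt y + q / sqrt y))\<close>.\<close>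

lemma nn_integral_inverse_gaussian:
  fixes p q :: real
  assumes "0 < p" "0 < q"
  shows "(\<integral>\<^sup>+y. ennreal (exp (- (p\<^sup>2 * y + q\<^sup>2 / y)) / (y * sqrt y)) * indicator {0<..} y \<partial>lborel)
    = ennreal (sqrt pi / q * exp (- 2 * p * q))"
proof -
  define \<Phi> where "\<Phi> = cdf std_normal_distribution"
  define u where "u y = sqrt 2 * (p * sqrt y - q / sqrt y)" for y
  define v where "v y = sqrt 2 * (p * sqrt y + q / sqrt y)" for y
  define F where "F y = sqrt pi / q * (exp (- 2 * p * q) * \<Phi> (u y) - exp (2 * p * q) * \<Phi> (v y))" for y
  define f where "f y = exp (- (p\<^sup>2 * y + q\<^sup>2 / y)) / (y * sqrt y)" for y
  interpret real_distribution std_normal_distribution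
    by (rule real_dist_normal_dist)
  have \<Phi>': "(\<Phi> has_real_derivative std_normal_density x) (at x)" for x
    unfolding \<Phi>_def using real_dist_normal_dist
    by (rule has_real_derivative_cdf_density)
      (auto simp: normal_density_def intro!: continuous_intros)
  have \<Phi>_top: "(\<Phi> \<longlongrightarrow> 1) at_top" and \<Phi>_bot: "(\<Phi> \<longlongrightarrow> 0) at_bot"
    unfolding \<Phi>_def by (rule cdf_lim_at_top_prob, rule cdf_lim_at_bot)
  have F': "(F has_real_derivative f y) (at y)" if "0 < y" for y
  proof -
    have u': "(u has_real_derivative sqrt 2 * (p / (2 * sqrt y) + q / (2 * y * sqrt y))) (at y)"
      unfolding u_def using that
      by (auto intro!: derivative_eq_intros simp: field_simps)
    have v': "(v has_real_derivative sqrt 2 * (p / (2 * sqrt y) - q / (2 * y * sqrt y))) (at y)"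
      unfolding v_def using that
      by (auto intro!: derivative_eq_intros simp: field_simps)
    have sq: "(u y)\<^sup>2 / 2 = p\<^sup>2 * y + q\<^sup>2 / y - 2 * p * q" "(v y)\<^sup>2 / 2 = p\<^sup>2 * y + q\<^sup>2 / y + 2 * p * q"
      unfolding u_def v_def using that
      by (simp_all add: power_mult_distrib power2_sum power2_diff power_divide)
    \<comment> \<open>The squares of \<open>u\<close> and \<open>v\<close> differ only in the sign
      of the cross term \<open>2 * p * q\<close>. The prefactors in \<open>F\<close> absorb exactly
      this term, so both summands carry the same exponential.\<close>
    have dens: "exp (- 2 * p * q) * std_normal_density (u y) = exp (- (p\<^sup>2 * y + q\<^sup>2 / y)) / sqrt (2 * pi)"
      "exp (2 * p * q) * std_normal_density (v y) = exp (- (p\<^sup>2 * y + q\<^sup>2 / y)) / sqrt (2 * pi)"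
      unfolding std_normal_density_def by (simp_all add: sq flip: exp_add)
    have "(F has_real_derivative sqrt pi / q *
        (exp (- 2 * p * q) * (std_normal_density (u y) * (sqrt 2 * (p / (2 * sqrt y) + q / (2 * y * sqrt y))))
        - exp (2 * p * q) * (std_normal_density (v y) * (sqrt 2 * (p / (2 * sqrt y) - q / (2 * y * sqrt y)))))) (at y)"
      unfolding F_def
      by (intro DERIV_cmult DERIV_diff DERIV_chain2[OF \<Phi>' u'] DERIV_chain2[OF \<Phi>' v'])
    \<comment> \<open>With the common exponential factored out, the \<open>p\<close> terms of the
      two inner derivatives cancel and the \<open>q\<close> terms add up. The factor
      \<open>sqrt pi / q\<close> normalises what is left.\<close>
    also have "sqrt pi / q *
        (exp (- 2 * p * q) * (std_normal_density (u y) * (sqrt 2 * (p / (2 * sqrt y) + q / (2 * y * sqrt y))))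
        - exp (2 * p * q) * (std_normal_density (v y) * (sqrt 2 * (p / (2 * sqrt y) - q / (2 * y * sqrt y))))) = f y"
      unfolding mult.assoc[symmetric] dens f_def using that assms
      by (simp add: real_sqrt_mult field_simps)
    finally show ?thesis .
  qed
  \<comment> \<open>At 0 the term \<open>q / sqrt y\<close> dominates and drives \<open>u\<close>
    and \<open>v\<close> to opposite infinities; at infinity \<open>p * sqrt y\<close> dominates and
    both tend to plus infinity. The \<open>v\<close> contributions thus cancel between the
    endpoints, and only \<open>exp (- 2 * p * q)\<close> survives.\<close>
  have lim0: "(F \<longlongrightarrow> sqrt pi / q * (exp (- 2 * p * q) * 0 - exp (2 * p * q) * 1)) (at_right 0)"
    unfolding F_def
  proof (intro tendsto_intros filterlim_compose[OF \<Phi>_bot] filterlim_compose[OF \<Phi>_top])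
    show "filterlim u at_bot (at_right 0)"
      unfolding u_def using assms by real_asymp
    show "filterlim v at_top (at_right 0)"
      unfolding v_def using assms by real_asymp
  qed
  have lim_top: "(F \<longlongrightarrow> sqrt pi / q * (exp (- 2 * p * q) * 1 - exp (2 * p * q) * 1)) at_top"
    unfolding F_def
  proof (intro tendsto_intros filterlim_compose[OF \<Phi>_top])
    show "filterlim u at_top at_top"
      unfolding u_def using assms by real_asymp
    show "filterlim v at_top at_top"
      unfolding v_def using assms by real_asymp
  qed
  have f_cont: "isCont f y" if "0 < y" for y
    unfolding f_def using that by (intro continuous_intros) auto
  have lim0': "((F \<circ> real_of_ereal) \<longlongrightarrow> sqrt pi / q * (exp (- 2 * p * q) * 0 - exp (2 * p * q) * 1))
      (at_right 0)"
    and lim_top': "((F \<circ> real_of_ereal) \<longlongrightarrow> sqrt pi / q * (exp (- 2 * p * q) * 1 - exp (2 * p * q) * 1))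
      (at_left \<infinity>)"
    using lim0 lim_top by (simp_all only: ereal_tendsto_simps1 zero_ereal_def)
  \<comment> \<open>Since \<open>f\<close> is nonnegative on the interval, the endpoint limits of
    \<open>F\<close> yield integrability together with the value of the integral.\<close>
  note FTC = interval_integral_FTC_nonneg[of 0 \<infinity> F f, OF _ _ _ _ lim0' lim_top']
  have FTC: "set_integrable lborel (einterval 0 \<infinity>) f"
    "(LBINT y=0..\<infinity>. f y) = sqrt pi / q * (exp (- 2 * p * q) * 1 - exp (2 * p * q) * 1)
       - sqrt pi / q * (exp (- 2 * p * q) * 0 - exp (2 * p * q) * 1)"
    using FTC F' f_cont by (auto simp: f_def)
  have ind: "einterval 0 \<infinity> = {0<..}"
    by (auto simp: einterval_def)
  have "(\<integral>\<^sup>+y. ennreal (f y) * indicator {0<..} y \<partial>lborel)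
      = (\<integral>\<^sup>+y. ennreal (indicator {0<..} y *\<^sub>R f y) \<partial>lborel)"
    by (intro nn_integral_cong) (auto split: split_indicator)
  also have "\<dots> = ennreal (\<integral>y. indicator {0<..} y *\<^sub>R f y \<partial>lborel)"
    using FTC(1) unfolding ind set_integrable_def
    by (intro nn_integral_eq_integral AE_I2) (auto split: split_indicator simp: f_def)
  also have "(\<integral>y. indicator {0<..} y *\<^sub>R f y \<partial>lborel) = sqrt pi / q * exp (- 2 * p * q)"
    using FTC(2) by (simp add: interval_lebesgue_integral_def ind set_lebesgue_integral_def
        algebra_simps)
  finally show ?thesis
    by (simp add: f_def)
qed

section \<open>Total mass of the Poincare density\<close>

lemma upper_half_plane_borel: "upper_half_plane \<in> sets borel"
proof -
  have "upper_half_plane = UNIV \<times> {0<..}"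
    by (auto simp: upper_half_plane_def)
  then have "open upper_half_plane"
    by (metis open_Times open_UNIV open_greaterThan)
  then show ?thesis
    by (rule borel_open)
qed

lemma poincare_density_borel_measurable: "poincare_density \<theta> \<in> borel_measurable borel"
  unfolding poincare_density_def Let_def borel_prod[symmetric] by measurable

text \<open>Completing the square in \<open>x\<close> splits off a normal density with mean
  \<open>- b / a\<close> and variance \<open>y / (2 * a)\<close>. By Tonelli its
  \<open>x\<close>-integral is 1, and the remaining factor \<open>g\<close> is an inverse Gaussian
  integrand in \<open>y\<close>.\<close>

lemma nn_integral_poincare_density:
  assumes "\<theta> \<in> Theta_v"
  shows "(\<integral>\<^sup>+\<omega>. ennreal (poincare_density \<theta> \<omega>) * indicator upper_half_plane \<omega> \<partial>lborel) = 1"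
proof -
  define a b c where "a = \<theta> $ 1" and "b = \<theta> $ 2" and "c = \<theta> $ 3"
  define s where "s = sqrt (a * c - b\<^sup>2)"
  have a: "0 < a" and D: "0 < a * c - b\<^sup>2"
    using assms by (auto simp: Theta_v_def a_def b_def c_def)
  then have s: "0 < s" and s2: "s\<^sup>2 = a * c - b\<^sup>2"
    by (auto simp: s_def)
  define p where "p = poincare_density \<theta>"
  \<comment> \<open>The parameters are chosen so that their product is \<open>s\<close>; the
    resulting \<open>exp (- 2 * s)\<close> is what the normalising constant of the density has to
    cancel.\<close>
  define g where "g y = exp (- ((sqrt a)\<^sup>2 * y + (s / sqrt a)\<^sup>2 / y)) / (y * sqrt y)" for y
  have p: "p (x, y) = s * exp (2 * s) / pi * exp (- ((a * (x\<^sup>2 + y\<^sup>2) + 2 * b * x + c) / y)) * (1 / y\<^sup>2)" for x y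
    by (simp add: p_def poincare_density_def Let_def a_def b_def c_def s_def)
  note [measurable] = upper_half_plane_borel
  have [measurable]: "p \<in> borel_measurable borel"
    unfolding p_def by (rule poincare_density_borel_measurable)
  \<comment> \<open>The constant left by the square is \<open>c - b^2 / a = s^2 / a\<close>. The
    normaliser of the normal density takes a factor \<open>1 / sqrt y\<close> out of
    \<open>1 / y^2\<close>, which leaves the weight \<open>1 / (y * sqrt y)\<close> of
    \<open>g\<close>.\<close>
  have fac: "p (x, y) = s * exp (2 * s) / sqrt (pi * a) * g y * normal_density (- (b / a)) (sqrt (y / (2 * a))) x"
    if "0 < y" for x y
  proof -
    have roots: "sqrt pi * (y * sqrt y) * (sqrt pi * sqrt y) = pi * (y * y)"
    proof -
      have "sqrt pi * (y * sqrt y) * (sqrt pi * sqrt y)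
          = (sqrt pi * sqrt pi) * y * (sqrt y * sqrt y)"
        by (simp only: mult_ac)
      then show ?thesis
        using that by simp
    qed
    have "a * (x\<^sup>2 + y\<^sup>2) + 2 * b * x + c = a * (x + b / a)\<^sup>2 + a * y\<^sup>2 + s\<^sup>2 / a"
      unfolding s2 using a by (simp add: field_simps power2_eq_square)
    then have "(a * (x\<^sup>2 + y\<^sup>2) + 2 * b * x + c) / y = (a * y + s\<^sup>2 / a / y) + a * (x + b / a)\<^sup>2 / y"
      using that by (simp add: add_divide_distrib power2_eq_square)
    then have "exp (- ((a * (x\<^sup>2 + y\<^sup>2) + 2 * b * x + c) / y))
        = exp (- (a * y + s\<^sup>2 / a / y)) * exp (- (a * (x + b / a)\<^sup>2 / y))"
      by (simp flip: exp_add)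
    moreover have "g y = exp (- (a * y + s\<^sup>2 / a / y)) / (y * sqrt y)"
      using a by (simp add: g_def power_divide)
    moreover have "normal_density (- (b / a)) (sqrt (y / (2 * a))) x
        = sqrt a / (sqrt pi * sqrt y) * exp (- (a * (x + b / a)\<^sup>2 / y))"
      using a that by (simp add: normal_density_def real_sqrt_divide real_sqrt_mult field_simps)
    ultimately show ?thesis
      using a that by (simp add: p real_sqrt_mult power2_eq_square roots)
  qed
  have inner: "(\<integral>\<^sup>+x. ennreal (p (x, y)) * indicator upper_half_plane (x, y) \<partial>lborel)
      = ennreal (s * exp (2 * s) / sqrt (pi * a)) * (ennreal (g y) * indicator {0<..} y)" for y
  proof (cases "0 < y")
    case True
    have g: "0 \<le> g y" using True by (simp add: g_def)
    have nd: "(\<integral>\<^sup>+x. ennreal (normal_density (- (b / a)) (sqrt (y / (2 * a))) x) \<partial>lborel) = 1"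
      using True a by (subst nn_integral_eq_integral) auto
    have "(\<integral>\<^sup>+x. ennreal (p (x, y)) * indicator upper_half_plane (x, y) \<partial>lborel)
        = (\<integral>\<^sup>+x. ennreal (s * exp (2 * s) / sqrt (pi * a) * g y)
            * ennreal (normal_density (- (b / a)) (sqrt (y / (2 * a))) x) \<partial>lborel)"
      using True s a g
      by (intro nn_integral_cong) (simp add: upper_half_plane_def fac flip: ennreal_mult'')
    also have "\<dots> = ennreal (s * exp (2 * s) / sqrt (pi * a) * g y)"
      by (simp add: nn_integral_cmult nd)
    finally show ?thesis
      using True s a g by (simp flip: ennreal_mult'')
  qed (simp add: upper_half_plane_def)
  have "(\<integral>\<^sup>+\<omega>. ennreal (p \<omega>) * indicator upper_half_plane \<omega> \<partial>lborel)
      = (\<integral>\<^sup>+y. \<integral>\<^sup>+x. ennreal (p (x, y)) * indicator upper_half_plane (x, y) \<partial>lborel \<partial>lborel)"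
    unfolding lborel_prod[symmetric]
    by (rule lborel_pair.nn_integral_snd[symmetric]) (simp add: lborel_prod)
  also have "\<dots> = ennreal (s * exp (2 * s) / sqrt (pi * a))
      * (\<integral>\<^sup>+y. ennreal (g y) * indicator {0<..} y \<partial>lborel)"
    unfolding inner g_def by (rule nn_integral_cmult) measurable
  also have "\<dots> = ennreal (s * exp (2 * s) / sqrt (pi * a))
      * ennreal (sqrt pi / (s / sqrt a) * exp (- 2 * sqrt a * (s / sqrt a)))"
    unfolding g_def using a s by (subst nn_integral_inverse_gaussian) auto
  also have "\<dots> = ennreal ((s * exp (2 * s) / sqrt (pi * a))
      * (sqrt pi / (s / sqrt a) * exp (- 2 * sqrt a * (s / sqrt a))))"
    using a s by (intro ennreal_mult[symmetric]) auto
  also have "(s * exp (2 * s) / sqrt (pi * a))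
      * (sqrt pi / (s / sqrt a) * exp (- 2 * sqrt a * (s / sqrt a))) = 1"
    using a s by (simp add: real_sqrt_mult exp_minus)
  finally show ?thesis
    by (simp add: p_def)
qed

lemma prob_space_poincare_density:
  assumes "\<theta> \<in> Theta_v"
  shows "prob_space (density (restrict_space lborel upper_half_plane)
    (\<lambda>\<omega>. ennreal (poincare_density \<theta> \<omega>)))"
proof
  let ?p = "\<lambda>\<omega>. ennreal (poincare_density \<theta> \<omega>)" and ?R = "restrict_space lborel upper_half_plane"
  have "emeasure (density ?R ?p) (space ?R) = (\<integral>\<^sup>+\<omega>. ?p \<omega> * indicator (space ?R) \<omega> \<partial>?R)"
    by (rule emeasure_density)
      (auto intro!: measurable_restrict_space1 measurable_compose[OF poincare_density_borel_measurable])
  also have "\<dots> = (\<integral>\<^sup>+\<omega>. ?p \<omega> \<partial>?R)"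
    by (rule nn_integral_cong) simp
  also have "\<dots> = 1"
    using upper_half_plane_borel nn_integral_poincare_density[OF assms] by (simp add: nn_integral_restrict_space)
  finally show "emeasure (density ?R ?p) (space (density ?R ?p)) = 1"
    by simp
qed

section \<open>Hessian of the log-density\<close>

text \<open>A constant integrates to itself against a probability measure. This reduces the Fisher
  information to the normalisation and one Hessian computation.\<close>

lemma fisher_information_const_hessian:
  fixes p :: "real ^ 'n \<Rightarrow> 'a \<Rightarrow> real"
  assumes "prob_space (density \<mu> (\<lambda>\<omega>. ennreal (p \<theta> \<omega>)))"
    and "\<And>\<omega>. \<omega> \<in> space \<mu> \<Longrightarrow> hessian (\<lambda>\<eta>. ln (p \<eta> \<omega>)) \<theta> = H"
  shows "fisher_information \<mu> p \<theta> = - H"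
proof -
  interpret prob_space "density \<mu> (\<lambda>\<omega>. ennreal (p \<theta> \<omega>))" by fact
  have "(\<integral>\<omega>. hessian (\<lambda>\<eta>. ln (p \<eta> \<omega>)) \<theta> \<partial>density \<mu> (\<lambda>\<omega>. ennreal (p \<theta> \<omega>)))
      = (\<integral>\<omega>. H \<partial>density \<mu> (\<lambda>\<omega>. ennreal (p \<theta> \<omega>)))"
    by (intro Bochner_Integration.integral_cong) (simp_all add: assms(2))
  also have "\<dots> = H"
    using prob_space by simp
  finally show ?thesis
    by (simp add: fisher_information_def)
qed

lemma partial_deriv_eqI:
  assumes "((\<lambda>t. f (\<theta> + t *\<^sub>R axis i 1)) has_real_derivative d) (at 0)"
  shows "partial_deriv i f \<theta> = d"
  using assms unfolding partial_deriv_def by (rule DERIV_imp_deriv)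

text \<open>For small \<open>t\<close> the line through \<theta> in direction \<open>i\<close> stays
  in the open set \<open>S\<close>. This locality allows the log-density to be replaced by a closed
  form that is valid only on \<open>S\<close>, even under iterated derivatives.\<close>

lemma partial_deriv_cong:
  assumes "open S" "\<theta> \<in> S" "\<And>\<eta>. \<eta> \<in> S \<Longrightarrow> f \<eta> = g \<eta>"
  shows "partial_deriv i f \<theta> = partial_deriv i g \<theta>"
  unfolding partial_deriv_def
proof (rule deriv_cong_ev)
  have "((\<lambda>t::real. \<theta> + t *\<^sub>R axis i 1) \<longlongrightarrow> \<theta> + 0 *\<^sub>R axis i 1) (nhds 0)"
    by (intro tendsto_intros filterlim_ident)
  then have "\<forall>\<^sub>F t in nhds 0. \<theta> + t *\<^sub>R axis i 1 \<in> S"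
    using assms(1,2) by (intro topological_tendstoD) auto
  then show "\<forall>\<^sub>F t in nhds 0. f (\<theta> + t *\<^sub>R axis i 1) = g (\<theta> + t *\<^sub>R axis i 1)"
    by eventually_elim (rule assms(3))
qed simp

text \<open>Chain rule for \<psi>(D) = ln D / 2 + 2 sqrt D: here \<open>\<psi>1\<close> and
  \<open>\<psi>2\<close> are its first and second derivatives at \<open>D\<close>, while
  \<open>G\<close> and \<open>K\<close> are the gradient and the Hessian of \<open>D\<close> in the
  coordinates \<open>(a, b, c)\<close>. The other terms of the log-density are affine and drop
  out.\<close>

lemma hessian_ln_poincare_density:
  fixes \<theta> :: "real ^ 3"
  defines "D \<equiv> \<theta> $ 1 * \<theta> $ 3 - (\<theta> $ 2)\<^sup>2"
  defines "\<psi>1 \<equiv> 1 / (2 * D) + 1 / sqrt D"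
    and "\<psi>2 \<equiv> - (1 / (2 * D\<^sup>2)) - 1 / (2 * D * sqrt D)"
    and "G \<equiv> vector [\<theta> $ 3, - 2 * \<theta> $ 2, \<theta> $ 1] :: real ^ 3"
    and "K \<equiv> vector [vector [0, 0, 1], vector [0, - 2, 0], vector [1, 0, 0]] :: real ^ 3 ^ 3"
  assumes "\<theta> \<in> Theta_v" "\<omega> \<in> upper_half_plane"
  shows "hessian (\<lambda>\<eta>. ln (poincare_density \<eta> \<omega>)) \<theta> = (\<chi> i j. \<psi>2 * (G $ i * G $ j) + \<psi>1 * K $ i $ j)"
proof -
  obtain x y where \<omega>: "\<omega> = (x, y)" and y: "0 < y"
    using assms by (auto simp: upper_half_plane_def)
  define d where "d \<eta> = \<eta> $ 1 * \<eta> $ 3 - (\<eta> $ 2)\<^sup>2" for \<eta> :: "real ^ 3"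
  \<comment> \<open>An open set containing \<open>Theta_v\<close>; positivity of \<open>d\<close> is
    what makes the logarithm and the square root in \<open>L\<close> differentiable.\<close>
  define S where "S = {\<eta>. 0 < d \<eta>}"
  \<comment> \<open>The coefficients of \<open>a\<close>, \<open>b\<close>, \<open>c\<close> in the
    negated exponent of the density; they enter the gradient \<open>P\<close> as constants and
    vanish at second order.\<close>
  define l :: "real ^ 3" where "l = vector [(x\<^sup>2 + y\<^sup>2) / y, 2 * x / y, 1 / y]"
  define m where "m \<eta> = \<eta> $ 1 * l $ 1 + \<eta> $ 2 * l $ 2 + \<eta> $ 3 * l $ 3" for \<eta> :: "real ^ 3"
  define L where "L \<eta> = ln (d \<eta>) / 2 + 2 * sqrt (d \<eta>) - ln pi
    - m \<eta> - 2 * ln y" for \<eta> :: "real ^ 3"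
  define G' :: "real ^ 3 \<Rightarrow> real ^ 3" where "G' \<eta> = vector [\<eta> $ 3, - 2 * \<eta> $ 2, \<eta> $ 1]" for \<eta> :: "real ^ 3"
  define P where "P j \<eta> = (1 / (2 * d \<eta>) + 1 / sqrt (d \<eta>)) * G' \<eta> $ j - l $ j" for j \<eta>
  have openS: "open S"
    unfolding S_def d_def by (intro open_Collect_less continuous_intros)
  have \<theta>: "\<theta> \<in> S"
    using assms by (simp add: S_def d_def Theta_v_def)
  have ln_eq: "ln (poincare_density \<eta> \<omega>) = L \<eta>" if "\<eta> \<in> S" for \<eta>
  proof -
    have "0 < d \<eta>" using that by (simp add: S_def)
    then show ?thesis using y
      by (simp add: poincare_density_def \<omega> Let_def ln_mult ln_div ln_sqrt ln_realpow d_def L_def m_def l_def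
          field_simps)
  qed
  have d': "((\<lambda>t. d (\<eta> + t *\<^sub>R axis j 1)) has_real_derivative G' \<eta> $ j) (at 0)" for \<eta> j
    unfolding d_def G'_def
    using exhaust_3[of j] by (auto simp: axis_def intro!: derivative_eq_intros)
  have L': "partial_deriv j L \<eta> = P j \<eta>" if "\<eta> \<in> S" for \<eta> j
  proof (rule partial_deriv_eqI)
    have "0 < d \<eta>" using that by (simp add: S_def)
    moreover have "((\<lambda>t. m (\<eta> + t *\<^sub>R axis j 1)) has_real_derivative l $ j) (at 0)"
      unfolding m_def
      using exhaust_3[of j] by (auto simp: axis_def intro!: derivative_eq_intros)
    ultimately show "((\<lambda>t. L (\<eta> + t *\<^sub>R axis j 1)) has_real_derivative P j \<eta>) (at 0)"
      unfolding L_def P_def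
      by (auto intro!: derivative_eq_intros d' simp: field_simps)
  qed
  have P': "partial_deriv i (P j) \<theta> = \<psi>2 * (G $ i * G $ j) + \<psi>1 * K $ i $ j" for i j
  proof (rule partial_deriv_eqI)
    have pos: "0 < d \<theta>" using \<theta> by (simp add: S_def)
    have "((\<lambda>t. G' (\<theta> + t *\<^sub>R axis i 1) $ j) has_real_derivative K $ i $ j) (at 0)"
      using exhaust_3[of i] exhaust_3[of j]
      by (auto simp: axis_def G'_def K_def intro!: derivative_eq_intros)
    moreover have "D = d \<theta>" "G = G' \<theta>"
      by (simp_all add: D_def d_def G_def G'_def)
    ultimately show "((\<lambda>t. P j (\<theta> + t *\<^sub>R axis i 1)) has_real_derivative \<psi>2 * (G $ i * G $ j) + \<psi>1 * K $ i $ j) (at 0)"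
      unfolding P_def \<psi>1_def \<psi>2_def using pos
      by (auto intro!: derivative_eq_intros d' simp: field_simps power2_eq_square)
  qed
  have "partial_deriv i (partial_deriv j (\<lambda>\<eta>. ln (poincare_density \<eta> \<omega>))) \<theta>
      = \<psi>2 * (G $ i * G $ j) + \<psi>1 * K $ i $ j" for i j
  proof -
    \<comment> \<open>The first derivative is identified on all of \<open>S\<close>, not only at
      \<theta>, so that it can be differentiated once more.\<close>
    have "partial_deriv j (\<lambda>\<eta>. ln (poincare_density \<eta> \<omega>)) \<eta> = P j \<eta>" if "\<eta> \<in> S" for \<eta>
      using partial_deriv_cong[OF openS that ln_eq] L'[OF that] by simp
    then show ?thesis
      using partial_deriv_cong[OF openS \<theta>] P' by metis
  qed
  then show ?thesis
    by (simp add: hessian_def)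
qed

section \<open>Entries of the Fisher information matrix\<close>

theorem mainTheorem7:
  fixes a b c :: real and I :: "real ^ 3 ^ 3"
  assumes "vector [a, b, c] \<in> Theta_v"
  defines "I \<equiv> poincare_fisher_information (vector [a, b, c])"
  shows "transpose I = I
    \<and> I $ 1 $ 1 = (c^2 * sqrt (a*c - b^2) + a*c^3 - b^2*c^2)
                  / (sqrt (a*c - b^2) * (2*a^2*c^2 - 4*a*b^2*c + 2*b^4))
    \<and> I $ 1 $ 2 = - ((b*c * sqrt (a*c - b^2) + a*b*c^2 - b^3*c)
                  / (sqrt (a*c - b^2) * (a^2*c^2 - 2*a*b^2*c + b^4)))
    \<and> I $ 1 $ 3 = - (((a*c - 2*b^2) * sqrt (a*c - b^2) - b^2)
                  / (2*a^2*c^2 - 4*a*b^2*c + 2*b^4))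
    \<and> I $ 2 $ 2 = (2*a*c * sqrt (a*c - b^2) + a*c + b^2)
                  / (a^2*c^2 - 2*a*b^2*c + b^4)
    \<and> I $ 2 $ 3 = - ((a*b * sqrt (a*c - b^2) + a^2*b*c - a*b^3)
                  / (sqrt (a*c - b^2) * (a^2*c^2 - 2*a*b^2*c + b^4)))
    \<and> I $ 3 $ 3 = (a^2 * sqrt (a*c - b^2) + a^3*c - a^2*b^2)
                  / (sqrt (a*c - b^2) * (2*a^2*c^2 - 4*a*b^2*c + 2*b^4))"
proof -
  define D where "D = a * c - b\<^sup>2"
  define s where "s = sqrt D"
  have D: "0 < D"
    using assms(1) by (simp add: Theta_v_def D_def)
  then have s: "0 < s" and s2: "D = s\<^sup>2"
    by (simp_all add: s_def)
  have a: "0 < a"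
    using assms(1) by (simp add: Theta_v_def)
  \<comment> \<open>Eliminating \<open>c\<close> builds the relation between \<open>s\<close> and
    \<open>a\<close>, \<open>b\<close>, \<open>c\<close> into the terms: each entry becomes an
    identity of rational functions in \<open>a\<close>, \<open>b\<close>, \<open>s\<close>.\<close>
  then have c: "c = (s\<^sup>2 + b\<^sup>2) / a"
    using s2 by (simp add: D_def field_simps)
  have I_eq: "I = - (\<chi> i j. (- (1 / (2 * D\<^sup>2)) - 1 / (2 * D * s))
      * ((vector [c, - 2 * b, a] :: real ^ 3) $ i * (vector [c, - 2 * b, a] :: real ^ 3) $ j)
      + (1 / (2 * D) + 1 / s)
      * (vector [vector [0, 0, 1], vector [0, - 2, 0], vector [1, 0, 0]] :: real ^ 3 ^ 3) $ i $ j)"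
    unfolding I_def poincare_fisher_information_def
  proof (rule fisher_information_const_hessian)
    show "prob_space (density (restrict_space lborel upper_half_plane)
        (\<lambda>\<omega>. ennreal (poincare_density (vector [a, b, c]) \<omega>)))"
      by (rule prob_space_poincare_density[OF assms(1)])
    fix \<omega> :: "real \<times> real"
    assume "\<omega> \<in> space (restrict_space lborel upper_half_plane)"
    then have "\<omega> \<in> upper_half_plane"
      by (simp add: space_restrict_space)
    from hessian_ln_poincare_density[OF assms(1) this]
    show "hessian (\<lambda>\<eta>. ln (poincare_density \<eta> \<omega>)) (vector [a, b, c])
      = (\<chi> i j. (- (1 / (2 * D\<^sup>2)) - 1 / (2 * D * s))
      * ((vector [c, - 2 * b, a] :: real ^ 3) $ i * (vector [c, - 2 * b, a] :: real ^ 3) $ j)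
      + (1 / (2 * D) + 1 / s)
      * (vector [vector [0, 0, 1], vector [0, - 2, 0], vector [1, 0, 0]] :: real ^ 3 ^ 3) $ i $ j)"
      by (simp add: D_def s_def)
  qed
  \<comment> \<open>The denominators of the statement are expanded forms of
    \<open>(a * c - b^2)^2\<close> and its double; likewise each numerator difference in
    \<open>num\<close> contains the factor \<open>D\<close>.\<close>
  have den: "a\<^sup>2 * c\<^sup>2 - 2 * a * b\<^sup>2 * c + b ^ 4 = D\<^sup>2"
    "2 * a\<^sup>2 * c\<^sup>2 - 4 * a * b\<^sup>2 * c + 2 * b ^ 4 = 2 * D\<^sup>2"
    by (simp_all add: D_def power2_eq_square power4_eq_xxxx algebra_simps)
  have num: "a * c ^ 3 - b\<^sup>2 * c\<^sup>2 = c\<^sup>2 * D" "a * b * c\<^sup>2 - b ^ 3 * c = b * c * D"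
    "a\<^sup>2 * b * c - a * b ^ 3 = a * b * D" "a ^ 3 * c - a\<^sup>2 * b\<^sup>2 = a\<^sup>2 * D"
    by (simp_all add: D_def power2_eq_square power3_eq_cube algebra_simps)
  have "transpose I = I"
    unfolding I_eq vec_eq_iff transpose_def forall_3 by (simp add: mult.commute)
  moreover have "I $ 1 $ 1 = (c\<^sup>2 * s + c\<^sup>2 * D) / (s * (2 * D\<^sup>2))"
    "I $ 1 $ 2 = - ((b * c * s + b * c * D) / (s * D\<^sup>2))"
    "I $ 1 $ 3 = - (((a * c - 2 * b\<^sup>2) * s - b\<^sup>2) / (2 * D\<^sup>2))"
    "I $ 2 $ 2 = (2 * a * c * s + a * c + b\<^sup>2) / D\<^sup>2"
    "I $ 2 $ 3 = - ((a * b * s + a * b * D) / (s * D\<^sup>2))"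
    "I $ 3 $ 3 = (a\<^sup>2 * s + a\<^sup>2 * D) / (s * (2 * D\<^sup>2))"
    unfolding I_eq using s a
    by (simp_all add: s2 c field_simps power2_eq_square)
  ultimately show ?thesis
    \<comment> \<open>Reversing \<open>add_diff_eq\<close> regroups \<open>x + y - z\<close> as
      \<open>x + (y - z)\<close>, which exposes the differences that \<open>num\<close>
      rewrites.\<close>
    unfolding den num add_diff_eq[symmetric] D_def[symmetric] s_def[symmetric] by simp
qed

end
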